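(* Let $n \geq 1$ be an integer. Every divisor on the complete graph $K_n$ is equivalent to a concentrated divisor on $K_n$.
   Context: $K_n$ is the complete graph with $n$ vertices $v_1, \ldots, v_n$, in which every pair of distinct vertices is joined by exactly one edge. A divisor on $K_n$ is a formal $\mathbb{Z}$-linear combination $D = \sum_{i=1}^n a_i v_i$ of the vertices (with $a_i \in \mathbb{Z}$, possibly negative). Firing a vertex $v_j$ replaces $D$ by the divisor obtained by decreasing the coefficient of $v_j$ by $n-1$ and increasing the coefficient of every other vertex by $1$. Two divisors are equivalent if one can be obtained from the other by a finite sequence of such chip-firing moves. A divisor $D = \sum_{i=1}^n a_i v_i$ on $K_n$ is concentrated if, for every integer $i$ with $1 \leq i \leq n$, we have $\# \{ j \in \{1,\ldots,n\} \mid a_j - \min_{1 \leq k \leq n} a_k \leq i-1 \} \geq i$. *)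

theory Defs
  imports Main
begin

text \<open>
  The vertices of \<open>K\<^sub>n\<close> are represented by the numbers \<open>1, \<dots>, n\<close>, and a divisor
  \<open>\<Sum>\<^sub>i a\<^sub>i v\<^sub>i\<close> by its coefficient function \<open>a\<close>, extended by zero outside \<open>{1..n}\<close>, so
  that equality of divisors is equality of functions.
\<close>

definition divisors :: "nat \<Rightarrow> (nat \<Rightarrow> int) set" where
  "divisors n = {D. \<forall>i. i \<notin> {1..n} \<longrightarrow> D i = 0}"

definition fire :: "nat \<Rightarrow> nat \<Rightarrow> (nat \<Rightarrow> int) \<Rightarrow> (nat \<Rightarrow> int)" where
  "fire n j D = (\<lambda>i. if i \<notin> {1..n} then D i
                     else if i = j then D i - (int n - 1)
                     else D i + 1)"

definition chip_firing_move :: "nat \<Rightarrow> (nat \<Rightarrow> int) \<Rightarrow> (nat \<Rightarrow> int) \<Rightarrow> bool" where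
  "chip_firing_move n D D' \<longleftrightarrow> (\<exists>j\<in>{1..n}. D' = fire n j D)"

text \<open>
  The direction is immaterial: firing all vertices other than \<open>v\<^sub>j\<close> undoes the firing of
  \<open>v\<^sub>j\<close>, see \<open>equivp_equivalent\<close> below.
\<close>

definition equivalent :: "nat \<Rightarrow> (nat \<Rightarrow> int) \<Rightarrow> (nat \<Rightarrow> int) \<Rightarrow> bool" where
  "equivalent n D D' \<longleftrightarrow> (chip_firing_move n)\<^sup>*\<^sup>* D D'"

definition concentrated :: "nat \<Rightarrow> (nat \<Rightarrow> int) \<Rightarrow> bool" where
  "concentrated n D \<longleftrightarrow>
     (\<forall>i\<in>{1..n}. card {j \<in> {1..n}. D j - Min (D ` {1..n}) \<le> int i - 1} \<ge> i)"

lemma fire_in_divisors: "D \<in> divisors n \<Longrightarrow> fire n j D \<in> divisors n"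
  by (auto simp: divisors_def fire_def)

lemma equivalent_fire_set:
  assumes "A \<subseteq> {1..n}"
  shows "equivalent n D (\<lambda>i. if i \<in> {1..n} then D i + int (card A) - (if i \<in> A then int n else 0) else D i)"
proof -
  have "finite A" using assms by (rule finite_subset) simp
  then show ?thesis using assms
  proof (induction A rule: finite_induct)
    case empty
    have "(\<lambda>i. if i \<in> {1..n} then D i + int (card ({} :: nat set)) - (if i \<in> {} then int n else 0) else D i) = D"
      by (rule ext) simp
    then show ?case unfolding equivalent_def by (simp only: rtranclp.rtrancl_refl)
  next
    case (insert a A)
    let ?D = "\<lambda>A i. if i \<in> {1..n} then D i + int (card A) - (if i \<in> A then int n else 0) else D i"
    have "?D (insert a A) = fire n a (?D A)"
      using insert.hyps by (auto simp: fire_def fun_eq_iff)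
    then have "chip_firing_move n (?D A) (?D (insert a A))"
      using insert.prems unfolding chip_firing_move_def by blast
    moreover have "equivalent n D (?D A)" using insert by blast
    ultimately show ?case
      unfolding equivalent_def by (rule rtranclp.rtrancl_into_rtrancl[rotated])
  qed
qed

lemma equivalent_fire_reverse:
  assumes "j \<in> {1..n}"
  shows "equivalent n (fire n j D) D"
proof -
  have "int (card ({1..n} - {j})) = int n - 1" using assms by (simp add: of_nat_diff)
  then have "(\<lambda>i. if i \<in> {1..n} then fire n j D i + int (card ({1..n} - {j})) -
      (if i \<in> {1..n} - {j} then int n else 0) else fire n j D i) = D"
    by (auto simp only: fire_def fun_eq_iff split: if_splits)
  with equivalent_fire_set[of "{1..n} - {j}" n "fire n j D"] show ?thesis by simp
qed

lemma equivp_equivalent: "equivp (equivalent n)"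
proof (rule equivpI)
  show "reflp (equivalent n)" by (auto simp: equivalent_def intro: reflpI)
  show "transp (equivalent n)" by (auto simp: equivalent_def intro: transpI)
  show "symp (equivalent n)"
  proof (rule sympI)
    fix D D' assume "equivalent n D D'"
    then have "(chip_firing_move n)\<^sup>*\<^sup>* D D'" by (simp add: equivalent_def)
    then show "equivalent n D' D"
    proof induction
      case base
      then show ?case by (simp add: equivalent_def)
    next
      case (step E F)
      then have "equivalent n F E"
        using equivalent_fire_reverse by (auto simp: chip_firing_move_def)
      with step.IH show ?case unfolding equivalent_def by (rule rtranclp_trans[rotated])
    qed
  qed
qed

end

theory Submission
  imports Defs
begin

text \<open>
  Firing moves preserve the total number of chips, so the smallest coefficient of a divisor cannot
  grow forever within an equivalence class: \<open>n\<close> times the minimum never exceeds the total. On the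
  other hand, if the counting condition fails at \<open>i\<close>, then only a few vertices, fewer than \<open>i\<close> of
  them, lie within \<open>i - 1\<close> of the minimum, while all the others lie at least \<open>i\<close> above it. Firing all
  those others at once costs each of them one chip per low vertex, so they stay strictly above the
  old minimum, and every low vertex gains. The minimum therefore strictly increases
  (\<open>Min_less_Min_fire_set\<close>), and repeating this must end in a concentrated divisor.
\<close>

text \<open>
  The net effect of firing each vertex of \<open>A\<close> once: a vertex of \<open>A\<close> gives away \<open>n - 1\<close> chips and
  receives \<open>card A - 1\<close>.
\<close>

definition fire_set :: "nat \<Rightarrow> nat set \<Rightarrow> (nat \<Rightarrow> int) \<Rightarrow> (nat \<Rightarrow> int)" where
  "fire_set n A D = (\<lambda>i. if i \<in> {1..n} then D i + int (card A) - (if i \<in> A then int n else 0) else D i)"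

lemma fire_set_in_divisors: "D \<in> divisors n \<Longrightarrow> fire_set n A D \<in> divisors n"
  by (auto simp: divisors_def fire_set_def)

lemma sum_fire_set:
  assumes "A \<subseteq> {1..n}"
  shows "sum (fire_set n A D) {1..n} = sum D {1..n}"
proof -
  have "sum (fire_set n A D) {1..n} = (\<Sum>i\<in>{1..n}. (D i + int (card A)) - (if i \<in> A then int n else 0))"
    by (rule sum.cong) (auto simp: fire_set_def)
  also have "\<dots> = sum D {1..n} + int n * int (card A) - (\<Sum>i\<in>{1..n}. if i \<in> A then int n else 0)"
    by (simp add: sum_subtractf sum.distrib)
  also have "(\<Sum>i\<in>{1..n}. if i \<in> A then int n else 0) = sum (\<lambda>_. int n) ({1..n} \<inter> A)"
    by (rule sum.inter_restrict[symmetric]) simp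
  also have "\<dots> = int n * int (card A)"
    using assms by (simp add: Int_absorb1)
  finally show ?thesis by simp
qed

text \<open>
  The low vertices are \<open>B\<close> and the fired ones \<open>A\<close>. A fired vertex goes down by \<open>n - card A = card B\<close>,
  which is less than \<open>i\<close> by assumption, from a height of at least \<open>i\<close> above the minimum. A low vertex
  goes up by \<open>card A\<close>, which is positive since \<open>card B < i \<le> n\<close>.
\<close>

lemma Min_less_Min_fire_set:
  assumes i: "i \<in> {1..n}"
    and few: "card {j \<in> {1..n}. D j - Min (D ` {1..n}) \<le> int i - 1} < i"
  defines "A \<equiv> {j \<in> {1..n}. D j - Min (D ` {1..n}) \<ge> int i}"
  shows "Min (D ` {1..n}) < Min (fire_set n A D ` {1..n})"
proof -
  let ?m = "Min (D ` {1..n})"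
  let ?B = "{j \<in> {1..n}. D j - ?m \<le> int i - 1}"
  have "card (A \<union> ?B) = card A + card ?B"
    by (rule card_Un_disjoint) (auto simp: A_def)
  moreover have "A \<union> ?B = {1..n}" by (auto simp: A_def)
  ultimately have card: "n = card A + card ?B" by simp
  have "?m < fire_set n A D j" if j: "j \<in> {1..n}" for j
  proof (cases "j \<in> A")
    case True
    then have "D j \<ge> ?m + int i" by (simp add: A_def)
    then show ?thesis using True j card few by (simp add: fire_set_def)
  next
    case False
    have "?m \<le> D j" using j by (intro Min_le) auto
    moreover have "card A > 0" using card few i by simp
    ultimately have "?m < D j + int (card A)" by linarith
    then show ?thesis using False j by (simp add: fire_set_def)
  qed
  moreover have "{1..n} \<noteq> {}" using i by auto
  ultimately show ?thesis by (subst Min_gr_iff) auto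
qed

lemma Min_times_le_sum:
  fixes D :: "nat \<Rightarrow> int"
  shows "int n * Min (D ` {1..n}) \<le> sum D {1..n}"
  using sum_bounded_below[of "{1..n}" "Min (D ` {1..n})" D] by simp

theorem proposition1p2:
  fixes n :: nat and D :: "nat \<Rightarrow> int"
  assumes "n \<ge> 1" and "D \<in> divisors n"
  shows "\<exists>D' \<in> divisors n. equivalent n D D' \<and> concentrated n D'"
  using assms(2)
  \<comment> \<open>Induction on the total height of the coefficients above their minimum.\<close>
proof (induction D rule: measure_induct_rule
    [where f = "\<lambda>D. nat (sum D {1..n} - int n * Min (D ` {1..n}))"])
  case (less D)
  show ?case
  proof (cases "concentrated n D")
    case True
    then show ?thesis using less.prems by (auto simp: equivalent_def)
  next
    case False
    then obtain i where i: "i \<in> {1..n}"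
      and few: "card {j \<in> {1..n}. D j - Min (D ` {1..n}) \<le> int i - 1} < i"
      unfolding concentrated_def by (meson not_le)
    define A where "A = {j \<in> {1..n}. D j - Min (D ` {1..n}) \<ge> int i}"
    let ?E = "fire_set n A D"
    have sub: "A \<subseteq> {1..n}" by (auto simp: A_def)
    have "Min (D ` {1..n}) < Min (?E ` {1..n})"
      unfolding A_def using i few by (rule Min_less_Min_fire_set)
    then have "int n * Min (D ` {1..n}) < int n * Min (?E ` {1..n})"
      using assms(1) by simp
    then have "nat (sum ?E {1..n} - int n * Min (?E ` {1..n}))
        < nat (sum D {1..n} - int n * Min (D ` {1..n}))"
      using Min_times_le_sum[of n ?E] sum_fire_set[OF sub, of D] by linarith
    then obtain D' where D': "D' \<in> divisors n" "equivalent n ?E D'" "concentrated n D'"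
      using less.IH fire_set_in_divisors[OF less.prems] by blast
    have "equivalent n D ?E"
      using equivalent_fire_set[OF sub] by (simp add: fire_set_def)
    then show ?thesis
      using D' equivp_transp[OF equivp_equivalent] by blast
  qed
qed

end
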